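(* Let $R$ be a unitary commutative ring which is an algebra over the rationals $\mathbb Q$. Then the edge-weighted path homology groups $H^{\mathbf e}_*(-,R)$ are homotopy invariant on the category $h\mathcal{DH}^1$ of weighted directed hypergraphs with $\delta_V\equiv1$; that is, if $G^\delta$, $H^\delta$ are weighted directed hypergraphs with all vertex weights equal to $1\in R$ and $f,g\colon G^\delta\to H^\delta$ are homotopic edge-weighted morphisms, then the induced homomorphisms $f_*,g_*\colon H^{\mathbf e}_*(G,R)\to H^{\mathbf e}_*(H,R)$ coincide.
   Context: All hypergraphs, digraphs and path complexes are finite; $R$ is a unitary commutative ring. Directed hypergraphs. A directed hypergraph $G=(V,E)$ is a finite set $V$ of vertices and a set $E$ of arrows, each arrow being an ordered pair $(A,B)$, written $A\to B$, of disjoint non-empty subsets of $V$, with $V=\bigcup_{(A\to B)\in E}(A\cup B)$. A morphism $f\colon G\to H$ is a pair of maps $f_V\colon V_G\to V_H$, $f_E\colon E_G\to E_H$ with $f_E(A\to B)=(f_V(A)\to f_V(B))$ for all $(A\to B)\in E_G$. A weighted directed hypergraph $G^\delta=(V,E,\delta_V)$ carries a function $\delta_V\colon V\to R$; for $X\subset V$ put $|X|=\sum_{x\in X}\delta_V(x)\in R$. A morphism $f$ between weighted directed hypergraphs is edge-weighted if for every $(A\to B)\in E_G$ with $f_E(A\to B)=(A'\to B')$ one has $|A|=|A'|$ and $|B|=|B'|$. $\mathbf P_{01}(G)$ is the set of all non-empty subsets of $V_G$ which are the origin $A$ or the end $B$ of some arrow $(A\to B)\in E_G$. Homotopy. $I_1$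 denotes either of the two digraphs $0\to1$ and $1\to0$ on $\{0,1\}$. The box product $G\Box I_1$ is the directed hypergraph with vertex set $V_G\times\{0,1\}$ and arrows $A\times\{i\}\to B\times\{i\}$ for $(A\to B)\in E_G$, $i\in\{0,1\}$, and $A\times\{i\}\to A\times\{j\}$ for $A\in\mathbf P_{01}(G)$, $(i\to j)$ the arrow of $I_1$. Morphisms $f_0,f_1\colon G\to H$ are one-step homotopic if for one of the two choices of $I_1$ there is a morphism $F\colon G\Box I_1\to H$ with $F|_{G\Box\{0\}}=f_0$, $F|_{G\Box\{1\}}=f_1$. Edge-weighted morphisms $f,g\colon G^\delta\to H^\delta$ are homotopic if there is a sequence of edge-weighted morphisms $f=f_0,f_1,\dots,f_n=g\colon G^\delta\to H^\delta$ with consecutive ones one-step homotopic. The category $h\mathcal{DH}^{e}$ has weighted directed hypergraphs as objects and homotopy classes of edge-weighted morphisms as morphisms; $h\mathcal{DH}^1$ is its subcategory of weighted directed hypergraphs with $\delta_V\equiv 1$. Weighted path complexes and their homology. A path complex $\Pi=(V,P)$ is a set $V$ with a set $P$ of finite sequences $(i_0\dots i_n)$, $n\geq 0$, of elements of $V$ such that all $(i)\in P$ and $(i_0\dots i_n)\in P$, $n\ge1$, implies $(i_0\dots i_{n-1}),(i_1\dots i_n)\in P$. A weighted path complex $\Pi^\delta=(V,P,\delta_V)$ carries $\delta_V\colon V\to R$; a weighted morphism is a map of vertices sending paths to paths and preserving weights. A path is regular if consecutive vertices are distinct. $\mathcal R_n^{reg}(V)$ ($n\ge0$) is the free $R$-module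 on regular paths $e_{i_0\dots i_n}$ on $V$ (non-regular $e_{i_0\dots i_n}$ are set to be $0$), $\mathcal R_n^{reg}(P)$ is the submodule generated by regular paths in $P$, $\mathcal R^{reg}_{-1}=0$. Put $\partial^w_0=0$, $\partial^w_n(e_{i_0\dots i_n})=\sum_{s=0}^n(-1)^s\delta_V(i_s)e_{i_0\dots\widehat{i_s}\dots i_n}$ for $n\ge1$; then $(\partial^w)^2=0$. Put $\Omega_{-1}^w=0$ and $\Omega^w_n(\Pi^\delta)=\{v\in\mathcal R^{reg}_n(P)\mid\partial^wv\in\mathcal R^{reg}_{n-1}(P)\}$ for $n\geq 0$; $H^{\mathbf w}_*(\Pi^\delta)$ is the homology of $(\Omega^w_*,\partial^w)$. A weighted morphism induces homomorphisms by $e_{i_0\dots i_n}\mapsto e_{f(i_0)\dots f(i_n)}$. Edge-weighted path homology. For a weighted directed hypergraph $G^\delta$, $\mathfrak N^w(G)$ is the weighted digraph with vertex set $\mathbf P_{01}(G)$, arrows $A\to B$ for $(A\to B)\in E_G$, and weight of a vertex $A$ equal to $|A|$. For a weighted digraph $D$ without loops, $\mathfrak D^w(D)$ is the weighted path complex on the vertices of $D$ (with the same weights) whose paths are the sequences $(i_0\dots i_n)$ such that $i_{k-1}\to i_k$ is an arrow of $D$ for $k=1,\dots,n$. Define $H^{\mathbf e}_*(G,R)=H^{\mathbf w}_*(\mathfrak D^w(\mathfrak N^w(G)))$. An edge-weighted morphism $f$ induces the weighted morphism $\mathfrak D^w\mathfrak N^w(G)\to\mathfrak D^w\mathfrak N^w(H)$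 given on vertices by $C\mapsto f_V(C)$, and hence $f_*$ on $H^{\mathbf e}_*$. *)

theory Defs
  imports Complex_Main "HOL-Library.Poly_Mapping" "HOL-Algebra.Coset"
begin

text \<open>
  The coefficient ring has sort \<open>{comm_ring, comm_monoid_mult}\<close>: unital commutative rings, with
  the zero ring allowed (\<open>comm_ring_1\<close> would add \<open>0 \<noteq> 1\<close>). An algebra over the rationals is
  such a ring with a unital ring homomorphism from \<^typ>\<open>rat\<close>.
\<close>

definition rat_algebra :: "(rat \<Rightarrow> 'r::{comm_ring, comm_monoid_mult}) \<Rightarrow> bool" where
  "rat_algebra \<phi> \<longleftrightarrow>
     \<phi> 1 = 1 \<and> (\<forall>x y. \<phi> (x + y) = \<phi> x + \<phi> y) \<and> (\<forall>x y. \<phi> (x * y) = \<phi> x * \<phi> y)"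


section \<open>Directed hypergraphs\<close>

record 'v dihypergraph =
  verts :: "'v set"
  arrows :: "('v set \<times> 'v set) set"

record ('v, 'r) weighted_dihypergraph = "'v dihypergraph" +
  weight :: "'v \<Rightarrow> 'r"

definition directed_hypergraph :: "('v, 'x) dihypergraph_scheme \<Rightarrow> bool" where
  "directed_hypergraph G \<longleftrightarrow>
     finite (verts G) \<and>
     (\<forall>(A, B) \<in> arrows G. A \<noteq> {} \<and> B \<noteq> {} \<and> A \<inter> B = {}) \<and>
     verts G = (\<Union>(A, B) \<in> arrows G. A \<union> B)"

definition set_weight ::
    "('v, 'r::{comm_ring, comm_monoid_mult}) weighted_dihypergraph \<Rightarrow> 'v set \<Rightarrow> 'r" where
  "set_weight G X = (\<Sum>x\<in>X. weight G x)"

definition P01 :: "('v, 'x) dihypergraph_scheme \<Rightarrow> 'v set set" where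
  "P01 G = fst ` arrows G \<union> snd ` arrows G"

record ('a, 'b) dh_map =
  vmap :: "'a \<Rightarrow> 'b"
  emap :: "'a set \<times> 'a set \<Rightarrow> 'b set \<times> 'b set"

definition dh_morphism ::
    "('a, 'x) dihypergraph_scheme \<Rightarrow> ('b, 'y) dihypergraph_scheme \<Rightarrow> ('a, 'b) dh_map \<Rightarrow> bool" where
  "dh_morphism G H f \<longleftrightarrow>
     vmap f ` verts G \<subseteq> verts H \<and>
     emap f ` arrows G \<subseteq> arrows H \<and>
     (\<forall>(A, B) \<in> arrows G. emap f (A, B) = (vmap f ` A, vmap f ` B))"

text \<open>Equality of morphisms out of \<open>G\<close>; values off the vertices and arrows of \<open>G\<close> are irrelevant.\<close>

definition dh_map_eq ::
    "('a, 'x) dihypergraph_scheme \<Rightarrow> ('a, 'b) dh_map \<Rightarrow> ('a, 'b) dh_map \<Rightarrow> bool" where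
  "dh_map_eq G f g \<longleftrightarrow>
     (\<forall>v \<in> verts G. vmap f v = vmap g v) \<and> (\<forall>a \<in> arrows G. emap f a = emap g a)"

definition edge_weighted_morphism ::
    "('a, 'r::{comm_ring, comm_monoid_mult}) weighted_dihypergraph \<Rightarrow>
     ('b, 'r) weighted_dihypergraph \<Rightarrow> ('a, 'b) dh_map \<Rightarrow> bool" where
  "edge_weighted_morphism G H f \<longleftrightarrow>
     dh_morphism G H f \<and>
     (\<forall>(A, B) \<in> arrows G. \<forall>A' B'. emap f (A, B) = (A', B') \<longrightarrow>
        set_weight G A = set_weight H A' \<and> set_weight G B = set_weight H B')"


section \<open>Homotopy\<close>

text \<open>
  The box product with the digraph on \<open>{0, 1}\<close> whose only arrow is \<open>i \<rightarrow> j\<close>; used only for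
  \<open>(i, j) = (0, 1)\<close> and \<open>(i, j) = (1, 0)\<close>.
\<close>

definition box_I1 ::
    "('v, 'x) dihypergraph_scheme \<Rightarrow> nat \<Rightarrow> nat \<Rightarrow> ('v \<times> nat) dihypergraph" where
  "box_I1 G i j =
     \<lparr>verts = verts G \<times> {0, 1},
      arrows = {(A \<times> {k}, B \<times> {k}) | A B k. (A, B) \<in> arrows G \<and> k \<in> {0, 1}}
             \<union> {(A \<times> {i}, A \<times> {j}) | A. A \<in> P01 G}\<rparr>"

text \<open>
  The restriction of \<open>F\<close> to the copy of \<open>G\<close> at height \<open>k\<close>. Its arrow component is transported back
  along the projection \<open>fst\<close>, which identifies subsets of \<open>V \<times> {k}\<close> with subsets of \<open>V\<close>.
\<close>

definition slice :: "('a \<times> nat, 'b) dh_map \<Rightarrow> nat \<Rightarrow> ('a, 'b) dh_map" where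
  "slice F k = \<lparr>vmap = (\<lambda>v. vmap F (v, k)), emap = (\<lambda>(A, B). emap F (A \<times> {k}, B \<times> {k}))\<rparr>"

definition one_step_homotopic ::
    "('a, 'x) dihypergraph_scheme \<Rightarrow> ('b, 'y) dihypergraph_scheme \<Rightarrow>
     ('a, 'b) dh_map \<Rightarrow> ('a, 'b) dh_map \<Rightarrow> bool" where
  "one_step_homotopic G H f0 f1 \<longleftrightarrow>
     (\<exists>(i, j) \<in> {(0, 1), (1, 0)}. \<exists>F. dh_morphism (box_I1 G i j) H F \<and>
        dh_map_eq G (slice F 0) f0 \<and> dh_map_eq G (slice F 1) f1)"

definition edge_homotopic ::
    "('a, 'r::{comm_ring, comm_monoid_mult}) weighted_dihypergraph \<Rightarrow>
     ('b, 'r) weighted_dihypergraph \<Rightarrow> ('a, 'b) dh_map \<Rightarrow> ('a, 'b) dh_map \<Rightarrow> bool" where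
  "edge_homotopic G H f g \<longleftrightarrow>
     (\<exists>n (h :: nat \<Rightarrow> ('a, 'b) dh_map).
        (\<forall>k\<le>n. edge_weighted_morphism G H (h k)) \<and>
        dh_map_eq G f (h 0) \<and> dh_map_eq G (h n) g \<and>
        (\<forall>k<n. one_step_homotopic G H (h k) (h (Suc k))))"


section \<open>Weighted path complexes and their homology\<close>

record ('v, 'r) weighted_path_complex =
  pverts :: "'v set"
  paths :: "'v list set"
  pweight :: "'v \<Rightarrow> 'r"

definition path_complex :: "('v, 'r, 'x) weighted_path_complex_scheme \<Rightarrow> bool" where
  "path_complex K \<longleftrightarrow>
     finite (pverts K) \<and>
     (\<forall>p \<in> paths K. p \<noteq> [] \<and> set p \<subseteq> pverts K) \<and>
     (\<forall>i \<in> pverts K. [i] \<in> paths K) \<and>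
     (\<forall>p \<in> paths K. length p \<ge> 2 \<longrightarrow> butlast p \<in> paths K \<and> tl p \<in> paths K)"

text \<open>
  Chains are finitely supported functions on sequences. Only regular sequences (those with
  \<^const>\<open>distinct_adj\<close>) carry a basis element; \<open>path_elem p\<close> is \<open>0\<close> for the other ones.
\<close>

type_synonym ('v, 'r) chain = "'v list \<Rightarrow>\<^sub>0 'r"

definition path_elem :: "'v list \<Rightarrow> ('v, 'r::{comm_ring, comm_monoid_mult}) chain" where
  "path_elem p = (if distinct_adj p then Poly_Mapping.single p 1 else 0)"

definition chain_scale ::
    "'r::{comm_ring, comm_monoid_mult} \<Rightarrow> ('v, 'r) chain \<Rightarrow> ('v, 'r) chain" where
  "chain_scale c v = Poly_Mapping.map ((*) c) v"

definition linear_extension ::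
    "('v list \<Rightarrow> ('w, 'r::{comm_ring, comm_monoid_mult}) chain) \<Rightarrow>
     ('v, 'r) chain \<Rightarrow> ('w, 'r) chain" where
  "linear_extension b v = (\<Sum>p\<in>Poly_Mapping.keys v. chain_scale (Poly_Mapping.lookup v p) (b p))"

lemma lookup_chain_scale [simp]:
  "Poly_Mapping.lookup (chain_scale c v) p = c * Poly_Mapping.lookup v p"
  by (simp add: chain_scale_def Poly_Mapping.map.rep_eq when_def)

text \<open>A path of degree \<open>n\<close> is a list of length \<open>n + 1\<close>.\<close>

definition reg_chains ::
    "('v, 'r::{comm_ring, comm_monoid_mult}) weighted_path_complex \<Rightarrow> nat \<Rightarrow> ('v, 'r) chain set" where
  "reg_chains K n =
     {v. Poly_Mapping.keys v \<subseteq> {p \<in> paths K. distinct_adj p \<and> length p = Suc n}}"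

definition path_boundary ::
    "('v \<Rightarrow> 'r) \<Rightarrow> 'v list \<Rightarrow> ('v, 'r::{comm_ring, comm_monoid_mult}) chain" where
  "path_boundary \<delta> p =
     (if length p \<le> 1 then 0
      else \<Sum>s<length p. chain_scale ((- 1) ^ s * \<delta> (p ! s)) (path_elem (take s p @ drop (Suc s) p)))"

definition boundary ::
    "('v, 'r::{comm_ring, comm_monoid_mult}) weighted_path_complex \<Rightarrow> ('v, 'r) chain \<Rightarrow> ('v, 'r) chain" where
  "boundary K = linear_extension (path_boundary (pweight K))"

definition Omega ::
    "('v, 'r::{comm_ring, comm_monoid_mult}) weighted_path_complex \<Rightarrow> nat \<Rightarrow> ('v, 'r) chain set" where
  "Omega K n =
     {v \<in> reg_chains K n. boundary K v \<in> (case n of 0 \<Rightarrow> {0} | Suc m \<Rightarrow> reg_chains K m)}"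

definition cycles ::
    "('v, 'r::{comm_ring, comm_monoid_mult}) weighted_path_complex \<Rightarrow> nat \<Rightarrow> ('v, 'r) chain set" where
  "cycles K n = {v \<in> Omega K n. boundary K v = 0}"

definition boundaries ::
    "('v, 'r::{comm_ring, comm_monoid_mult}) weighted_path_complex \<Rightarrow> nat \<Rightarrow> ('v, 'r) chain set" where
  "boundaries K n = boundary K ` Omega K (Suc n)"

definition cycle_group ::
    "('v, 'r::{comm_ring, comm_monoid_mult}) weighted_path_complex \<Rightarrow> nat \<Rightarrow> ('v, 'r) chain monoid" where
  "cycle_group K n = \<lparr>carrier = cycles K n, monoid.mult = (+), one = 0\<rparr>"

definition path_homology ::
    "('v, 'r::{comm_ring, comm_monoid_mult}) weighted_path_complex \<Rightarrow> nat \<Rightarrow> ('v, 'r) chain set monoid" where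
  "path_homology K n = cycle_group K n Mod boundaries K n"

definition chain_map ::
    "('v \<Rightarrow> 'w) \<Rightarrow> ('v, 'r::{comm_ring, comm_monoid_mult}) chain \<Rightarrow> ('w, 'r) chain" where
  "chain_map f = linear_extension (\<lambda>p. path_elem (map f p))"

text \<open>
  The class of a cycle \<open>z\<close> is sent to the class of \<open>chain_map f z\<close>. All members of the union are the
  same coset when \<open>f\<close> is a weighted morphism.
\<close>

definition path_homology_map ::
    "('v, 'r::{comm_ring, comm_monoid_mult}) weighted_path_complex \<Rightarrow>
     ('w, 'r) weighted_path_complex \<Rightarrow> nat \<Rightarrow> ('v \<Rightarrow> 'w) \<Rightarrow>
     ('v, 'r) chain set \<Rightarrow> ('w, 'r) chain set" where
  "path_homology_map K L n f =
     (\<lambda>c \<in> carrier (path_homology K n).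
        \<Union>z\<in>c. boundaries L n #>\<^bsub>cycle_group L n\<^esub> chain_map f z)"


section \<open>Edge-weighted path homology\<close>

record ('v, 'r) weighted_digraph =
  dverts :: "'v set"
  darrows :: "('v \<times> 'v) set"
  dweight :: "'v \<Rightarrow> 'r"

definition Nw ::
    "('v, 'r::{comm_ring, comm_monoid_mult}) weighted_dihypergraph \<Rightarrow> ('v set, 'r) weighted_digraph" where
  "Nw G = \<lparr>dverts = P01 G, darrows = arrows G, dweight = set_weight G\<rparr>"

definition Dw :: "('v, 'r) weighted_digraph \<Rightarrow> ('v, 'r) weighted_path_complex" where
  "Dw D =
     \<lparr>pverts = dverts D,
      paths = {p. p \<noteq> [] \<and> set p \<subseteq> dverts D \<and> successively (\<lambda>i j. (i, j) \<in> darrows D) p},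
      pweight = dweight D\<rparr>"

lemma path_complex_Dw_Nw:
  assumes "directed_hypergraph G"
  shows "path_complex (Dw (Nw G))"
proof -
  have "arrows G \<subseteq> Pow (verts G) \<times> Pow (verts G)" "finite (verts G)"
    using assms unfolding directed_hypergraph_def by fast+
  then have "finite (P01 G)"
    unfolding P01_def by (meson finite_Pow_iff finite_SigmaI finite_UnI finite_imageI finite_subset)
  moreover have "butlast p \<noteq> []" "tl p \<noteq> []" if "length p \<ge> 2" for p :: "'a set list"
    using that by (cases p; cases "tl p"; auto)+
  moreover have "successively Q (butlast p) \<and> successively Q (tl p)" if "successively Q p"
    for Q and p :: "'a set list"
    using that by (induction p rule: induct_list012) (auto simp: successively_Cons)
  ultimately show ?thesis
    unfolding path_complex_def Dw_def Nw_def
    by (auto dest: in_set_butlastD list.set_sel(2))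
qed

lemma Dw_Nw_regular:
  assumes "directed_hypergraph G" "p \<in> paths (Dw (Nw G))"
  shows "distinct_adj p"
proof -
  have "successively (\<lambda>i j. (i, j) \<in> arrows G) p"
    using assms(2) by (simp add: Dw_def Nw_def)
  moreover have "A \<noteq> B" if "(A, B) \<in> arrows G" for A B
    using assms(1) that unfolding directed_hypergraph_def by fast
  ultimately show ?thesis
    unfolding distinct_adj_def by (rule successively_mono)
qed

definition edge_homology ::
    "('v, 'r::{comm_ring, comm_monoid_mult}) weighted_dihypergraph \<Rightarrow> nat \<Rightarrow>
     ('v set, 'r) chain set monoid" where
  "edge_homology G n = path_homology (Dw (Nw G)) n"

definition edge_homology_map ::
    "('a, 'r::{comm_ring, comm_monoid_mult}) weighted_dihypergraph \<Rightarrow>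
     ('b, 'r) weighted_dihypergraph \<Rightarrow> nat \<Rightarrow> ('a, 'b) dh_map \<Rightarrow>
     ('a set, 'r) chain set \<Rightarrow> ('b set, 'r) chain set" where
  "edge_homology_map G H n f = path_homology_map (Dw (Nw G)) (Dw (Nw H)) n (\<lambda>C. vmap f ` C)"

end

theory Submission
  imports Defs
begin

text \<open>
  A one-step homotopy supplies, for every \<open>A \<in> P01 G\<close>, an arrow of \<open>H\<close> between \<open>f(A)\<close> and \<open>g(A)\<close>,
  and both ends have the weight \<open>|A|\<close>. This gives the classical prism chain homotopy, except that
  the two inner faces of the \<open>k\<close>-th simplex of the prism carry the factor \<open>|i\<^sub>k|\<close>. When all
  vertex weights are \<open>1\<close>, \<open>|i\<^sub>k|\<close> is a positive integer, hence invertible over \<open>\<rat>\<close>, and dividing the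
  \<open>k\<close>-th summand of the prism by it makes the sum telescope. The identities are proved by recursion on
  arbitrary sequences, where a sequence \<open>a # p\<close> is a cone over \<open>p\<close>, and then projected to regular
  sequences.
\<close>

section \<open>Linear extensions\<close>

lemma chain_scale_simps [simp]:
  fixes v :: "('v, 'r::{comm_ring, comm_monoid_mult}) chain"
  shows "chain_scale c 0 = (0 :: ('v, 'r) chain)" "chain_scale 0 v = 0" "chain_scale 1 v = v"
    "chain_scale c (chain_scale d v) = chain_scale (c * d) v"
    "chain_scale c (Poly_Mapping.single p d) = (Poly_Mapping.single p (c * d) :: ('v, 'r) chain)"
  by (auto intro!: poly_mapping_eqI simp: lookup_single when_def mult.assoc)

lemma chain_scale_add:
  "chain_scale c (v + w) = chain_scale c v + chain_scale c w"
  "chain_scale (c + d) v = chain_scale c v + chain_scale d v"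
  "chain_scale c (v - w) = chain_scale c v - chain_scale c w"
  "chain_scale c (- v) = - chain_scale c v"
  "chain_scale (- c) v = - chain_scale c v"
  by (auto intro!: poly_mapping_eqI simp: lookup_add lookup_minus algebra_simps)

lemma chain_scale_sum: "chain_scale c (sum f A) = (\<Sum>x\<in>A. chain_scale c (f x))"
  by (induction A rule: infinite_finite_induct) (auto simp: chain_scale_add)

text \<open>Allows one index set for several chains at once. Additivity needs this, because the
  support of a sum can be smaller than the union of the supports.\<close>

lemma linear_extension_superset:
  assumes "finite S" "Poly_Mapping.keys v \<subseteq> S"
  shows "linear_extension b v = (\<Sum>p\<in>S. chain_scale (Poly_Mapping.lookup v p) (b p))"
  unfolding linear_extension_def
  by (rule sum.mono_neutral_left) (use assms in \<open>auto simp: in_keys_iff\<close>)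

lemma linear_extension_0 [simp]: "linear_extension b 0 = 0"
  by (simp add: linear_extension_def)

lemma linear_extension_single [simp]:
  "linear_extension b (Poly_Mapping.single p c) = chain_scale c (b p)"
  by (simp add: linear_extension_superset[of "{p}"])

lemma linear_extension_add [simp]:
  "linear_extension b (v + w) = linear_extension b v + linear_extension b w"
proof -
  let ?S = "Poly_Mapping.keys v \<union> Poly_Mapping.keys w"
  have "Poly_Mapping.keys (v + w) \<subseteq> ?S"
    by (rule Poly_Mapping.keys_add)
  then show ?thesis
    by (simp add: linear_extension_superset[of ?S] lookup_add chain_scale_add sum.distrib)
qed

lemma linear_extension_scale [simp]:
  "linear_extension b (chain_scale c v) = chain_scale c (linear_extension b v)"
proof -
  have "Poly_Mapping.keys (chain_scale c v) \<subseteq> Poly_Mapping.keys v"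
    by (auto simp: in_keys_iff)
  then show ?thesis
    by (simp add: linear_extension_superset[of "Poly_Mapping.keys v"] chain_scale_sum)
qed

lemma linear_extension_uminus [simp]: "linear_extension b (- v) = - linear_extension b v"
  using linear_extension_add[of b v "- v"] by (simp add: eq_neg_iff_add_eq_0 add.commute)

lemma linear_extension_diff [simp]:
  "linear_extension b (v - w) = linear_extension b v - linear_extension b w"
  using linear_extension_add[of b v "- w"] by simp

lemma linear_extension_sum:
  "linear_extension b (sum f A) = (\<Sum>x\<in>A. linear_extension b (f x))"
  by (induction A rule: infinite_finite_induct) auto

lemma linear_extension_cong:
  "(\<And>p. p \<in> Poly_Mapping.keys v \<Longrightarrow> b p = c p) \<Longrightarrow> linear_extension b v = linear_extension c v"
  by (simp add: linear_extension_def)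

lemma linear_extension_linear_extension:
  "linear_extension b (linear_extension c v) = linear_extension (\<lambda>p. linear_extension b (c p)) v"
  by (simp add: linear_extension_def[of c] linear_extension_def[of "\<lambda>p. linear_extension b (c p)"]
      linear_extension_sum)

lemma linear_extension_fun_diff:
  "linear_extension (\<lambda>p. b p - c p) v = linear_extension b v - linear_extension c v"
  by (simp add: linear_extension_def chain_scale_add sum_subtractf)

lemma linear_extension_fun_add:
  "linear_extension (\<lambda>p. b p + c p) v = linear_extension b v + linear_extension c v"
  by (simp add: linear_extension_def chain_scale_add sum.distrib)

lemma linear_extension_fun_scale:
  "linear_extension (\<lambda>p. chain_scale d (b p)) v = chain_scale d (linear_extension b v)"
  by (simp add: linear_extension_def chain_scale_sum mult.commute)

lemma linear_extension_id:
  fixes v :: "('v, 'r::{comm_ring, comm_monoid_mult}) chain"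
  shows "linear_extension (\<lambda>p. Poly_Mapping.single p 1) v = v"
  by (rule poly_mapping_eqI)
    (simp add: linear_extension_def lookup_sum lookup_single when_def in_keys_iff)

lemma keys_linear_extension:
  assumes "\<And>p. p \<in> Poly_Mapping.keys v \<Longrightarrow> Poly_Mapping.keys (b p) \<subseteq> S"
  shows "Poly_Mapping.keys (linear_extension b v) \<subseteq> S"
proof -
  have "Poly_Mapping.keys (chain_scale c (b p)) \<subseteq> Poly_Mapping.keys (b p)" for c p
    by (auto simp: in_keys_iff)
  then have "(\<Union>p\<in>Poly_Mapping.keys v.
      Poly_Mapping.keys (chain_scale (Poly_Mapping.lookup v p) (b p))) \<subseteq> S"
    using assms by fast
  then show ?thesis
    unfolding linear_extension_def using Poly_Mapping.keys_sum by (rule subset_trans[rotated])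
qed


section \<open>The prism operator on all sequences\<close>

definition cone :: "'v \<Rightarrow> ('v, 'r::{comm_ring, comm_monoid_mult}) chain \<Rightarrow> ('v, 'r) chain" where
  "cone a = linear_extension (\<lambda>p. Poly_Mapping.single (a # p) 1)"

text \<open>Unlike \<open>chain_map\<close>, this keeps non-regular images, so that it commutes with
  \<open>cone\<close> exactly.\<close>

definition push :: "('v \<Rightarrow> 'w) \<Rightarrow> ('v, 'r::{comm_ring, comm_monoid_mult}) chain \<Rightarrow> ('w, 'r) chain" where
  "push f = linear_extension (\<lambda>p. Poly_Mapping.single (map f p) 1)"

text \<open>
  Unlike \<^const>\<open>path_boundary\<close>, this boundary keeps non-regular sequences and is augmented:
  it sends \<open>[a]\<close> to a multiple of the empty sequence.
\<close>

primrec free_bd :: "('v \<Rightarrow> 'r::{comm_ring, comm_monoid_mult}) \<Rightarrow> 'v list \<Rightarrow> ('v, 'r) chain" where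
  "free_bd \<delta> [] = 0"
| "free_bd \<delta> (a # p) = Poly_Mapping.single p (\<delta> a) - cone a (free_bd \<delta> p)"

text \<open>
  Unfolded, \<open>prism u x y [i\<^sub>0, \<dots>, i\<^sub>n]\<close> is the sum over \<open>k\<close> of
  \<open>(-1)\<^sup>k u(i\<^sub>k) [x i\<^sub>0, \<dots>, x i\<^sub>k, y i\<^sub>k, \<dots>, y i\<^sub>n]\<close>.
\<close>

primrec prism :: "('v \<Rightarrow> 'r::{comm_ring, comm_monoid_mult}) \<Rightarrow> ('v \<Rightarrow> 'w) \<Rightarrow> ('v \<Rightarrow> 'w) \<Rightarrow>
    'v list \<Rightarrow> ('w, 'r) chain" where
  "prism u x y [] = 0"
| "prism u x y (a # p) =
     Poly_Mapping.single (x a # y a # map y p) (u a) - cone (x a) (prism u x y p)"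

lemma cone_simps [simp]:
  "cone a 0 = 0" "cone a (v + w) = cone a v + cone a w" "cone a (v - w) = cone a v - cone a w"
  "cone a (chain_scale c v) = chain_scale c (cone a v)"
  "cone a (Poly_Mapping.single p c) = Poly_Mapping.single (a # p) c"
  by (simp_all add: cone_def)

lemma push_simps [simp]:
  "push f 0 = 0" "push f (v + w) = push f v + push f w" "push f (v - w) = push f v - push f w"
  "push f (chain_scale c v) = chain_scale c (push f v)"
  "push f (Poly_Mapping.single p c) = Poly_Mapping.single (map f p) c"
  by (simp_all add: push_def)

lemma push_cone: "push f (cone a v) = cone (f a) (push f v)"
  by (simp add: push_def cone_def linear_extension_linear_extension)

lemma linear_extension_single_id:
  "linear_extension (\<lambda>p. Poly_Mapping.single p c) v = chain_scale c v"
  using linear_extension_fun_scale[of c "\<lambda>p. Poly_Mapping.single p 1" v]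
  by (simp add: linear_extension_id)

lemma free_bd_cone:
  "linear_extension (free_bd \<delta>) (cone a v) =
     chain_scale (\<delta> a) v - cone a (linear_extension (free_bd \<delta>) v)"
  by (simp add: cone_def linear_extension_linear_extension linear_extension_fun_diff
      linear_extension_single_id)

lemma linear_extension_single_comp:
  "linear_extension (\<lambda>p. Poly_Mapping.single (f p) c) v =
     chain_scale c (linear_extension (\<lambda>p. Poly_Mapping.single (f p) 1) v)"
  using linear_extension_fun_scale[of c "\<lambda>p. Poly_Mapping.single (f p) 1" v] by simp

lemma prism_cone:
  "linear_extension (prism u x y) (cone a v) =
     chain_scale (u a) (cone (x a) (cone (y a) (push y v)))
       - cone (x a) (linear_extension (prism u x y) v)"
  by (simp add: cone_def push_def linear_extension_linear_extension linear_extension_fun_diff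
      linear_extension_single_comp[of _ "u a"])

text \<open>By \<open>free_bd_cone\<close> the two copies of \<open>\<delta> a\<close> times the
  boundary of \<open>p\<close> cancel; the rest is the cone over the twice applied boundary of
  \<open>p\<close>, zero by induction.\<close>

lemma free_bd_free_bd: "linear_extension (free_bd \<delta>) (free_bd \<delta> p) = 0"
proof (induction p)
  case (Cons a p)
  then show ?case by (simp add: free_bd_cone)
qed simp

lemma free_bd_map:
  assumes "\<And>a. a \<in> set p \<Longrightarrow> \<epsilon> (f a) = \<delta> a"
  shows "free_bd \<epsilon> (map f p) = push f (free_bd \<delta> p)"
  using assms by (induction p) (auto simp: push_cone)

text \<open>Induction on the cone structure: coning the identity for \<open>p\<close> with
  \<open>x a\<close> yields the identity for \<open>a # p\<close> up to the faces of the new first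
  simplex. The factor \<open>u\<close> cancels the weights of its two inner vertices.\<close>

lemma prism_homotopy:
  assumes "\<And>a. a \<in> set p \<Longrightarrow> \<epsilon> (x a) = \<delta> a \<and> \<epsilon> (y a) = \<delta> a \<and> u a * \<delta> a = 1"
  shows "linear_extension (free_bd \<epsilon>) (prism u x y p)
      + linear_extension (prism u x y) (free_bd \<delta> p) =
    Poly_Mapping.single (map y p) 1 - Poly_Mapping.single (map x p) 1"
  using assms
proof (induction p)
  case (Cons a p)
  have a: "\<epsilon> (x a) = \<delta> a" "\<epsilon> (y a) = \<delta> a" "u a * \<delta> a = 1"
    using Cons.prems by auto
  let ?D = "linear_extension (free_bd \<epsilon>)" and ?L = "linear_extension (prism u x y)"
  have bd: "free_bd \<epsilon> (map y p) = push y (free_bd \<delta> p)"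
    using Cons.prems by (intro free_bd_map) auto
  have "?D (prism u x y p) + ?L (free_bd \<delta> p) =
      Poly_Mapping.single (map y p) 1 - Poly_Mapping.single (map x p) 1"
    using Cons by auto
  from arg_cong[OF this, of "cone (x a)"]
  have IH: "cone (x a) (?D (prism u x y p)) + cone (x a) (?L (free_bd \<delta> p)) =
      Poly_Mapping.single (x a # map y p) 1 - Poly_Mapping.single (x a # map x p) 1"
    by simp
  \<comment> \<open>The terms \<open>\<delta> a\<close> times the prism of \<open>p\<close> cancel,
    and so do those with \<open>x a\<close> and \<open>y a\<close> coned over the pushed boundary of
    \<open>p\<close>. There remain the faces omitting \<open>x a\<close> and \<open>y a\<close>; the
    latter cancels against a term of \<open>IH\<close>.\<close>
  have "?D (prism u x y (a # p)) + ?L (free_bd \<delta> (a # p)) =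
      Poly_Mapping.single (y a # map y p) 1 - Poly_Mapping.single (x a # map y p) 1
      + (cone (x a) (?D (prism u x y p)) + cone (x a) (?L (free_bd \<delta> p)))"
    by (simp add: free_bd_cone prism_cone bd a chain_scale_add)
  then show ?case
    by (simp add: IH)
qed simp


section \<open>Passing to regular sequences\<close>

text \<open>Represents the quotient by non-regular sequences. It retains \<open>[]\<close>, whose
  cone \<open>[a]\<close> is regular, so that coning is compatible with it.\<close>

definition regularize :: "('v, 'r::{comm_ring, comm_monoid_mult}) chain \<Rightarrow> ('v, 'r) chain" where
  "regularize = linear_extension path_elem"

text \<open>Projection to non-empty regular sequences; dropping \<open>[]\<close> removes the augmentation.\<close>

definition reg_elem :: "'v list \<Rightarrow> ('v, 'r::{comm_ring, comm_monoid_mult}) chain" where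
  "reg_elem p = (if p = [] then 0 else path_elem p)"

lemma path_elem_simps [simp]:
  "distinct_adj p \<Longrightarrow> path_elem p = Poly_Mapping.single p 1"
  "\<not> distinct_adj p \<Longrightarrow> path_elem p = 0"
  by (simp_all add: path_elem_def)

text \<open>A non-regular sequence stays non-regular when a vertex is prepended.\<close>

lemma regularize_cone: "regularize (cone a (regularize v)) = regularize (cone a v)"
  unfolding regularize_def cone_def linear_extension_linear_extension
  by (rule linear_extension_cong) (auto simp: path_elem_def distinct_adj_Cons)

lemma regularize_cone_eq_0: "regularize v = 0 \<Longrightarrow> regularize (cone a v) = 0"
  by (metis regularize_cone cone_simps(1) regularize_def linear_extension_0)

lemma regularize_cone_cone: "regularize (cone a (cone a v)) = 0"
proof -
  have "regularize (cone a (cone a v)) = linear_extension (\<lambda>p. 0) v"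
    by (simp add: regularize_def cone_def linear_extension_linear_extension path_elem_def)
  then show ?thesis
    by (simp add: linear_extension_def)
qed

text \<open>For a repetition \<open>a, a\<close> at the front, the faces omitting either copy
  coincide, have the same weight and opposite signs, and so cancel; all other faces still contain
  the repetition. A later repetition is handled by coning.\<close>

lemma regularize_free_bd:
  "\<not> distinct_adj p \<Longrightarrow> regularize (free_bd \<delta> p) = 0"
proof (induction p)
  case (Cons a p)
  show ?case
  proof (cases "distinct_adj p")
    case False
    then have "regularize (cone a (free_bd \<delta> p)) = 0"
      using Cons.IH by (intro regularize_cone_eq_0) auto
    with False show ?thesis
      by (simp add: regularize_def)
  next
    case True
    with Cons.prems obtain q where "p = a # q"
      by (cases p) auto
    then show ?thesis
      using regularize_cone_cone[of a "free_bd \<delta> q"] by (simp add: regularize_def)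
  qed
qed simp

lemma distinct_adj_map_False: "\<not> distinct_adj p \<Longrightarrow> \<not> distinct_adj (map f p)"
  by (induction p rule: induct_list012) auto

text \<open>Here no cancellation occurs: a repeated vertex makes every summand repeat a value of
  \<open>x\<close> or of \<open>y\<close>.\<close>

lemma regularize_prism:
  "\<not> distinct_adj p \<Longrightarrow> regularize (prism u x y p) = 0"
proof (induction p)
  case (Cons a p)
  show ?case
  proof (cases "distinct_adj p")
    case False
    then have "regularize (cone (x a) (prism u x y p)) = 0"
      using Cons.IH by (intro regularize_cone_eq_0) auto
    moreover have "\<not> distinct_adj (x a # y a # map y p)"
      using distinct_adj_map_False[OF False, of y] by (auto simp: distinct_adj_Cons)
    ultimately show ?thesis
      by (simp add: regularize_def)
  next
    case True
    with Cons.prems obtain q where "p = a # q"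
      by (cases p) auto
    then show ?thesis
      using regularize_cone_cone[of "x a" "prism u x y q"] by (simp add: regularize_def)
  qed
qed simp

lemma reg_elem_regularize:
  "linear_extension reg_elem (regularize v) = linear_extension reg_elem v"
  unfolding regularize_def linear_extension_linear_extension
  by (rule linear_extension_cong) (auto simp: path_elem_def reg_elem_def)

text \<open>Operators that respect the non-regular sequences descend to the quotient, so a
  projection placed before them may be dropped. The condition at \<open>[]\<close> is there because
  \<open>reg_elem\<close> also discards the empty sequence.\<close>

lemma reg_elem_absorb:
  assumes "b [] = 0" "\<And>p. \<not> distinct_adj p \<Longrightarrow> regularize (b p) = 0"
  shows "linear_extension reg_elem (linear_extension b (linear_extension reg_elem v)) =
    linear_extension reg_elem (linear_extension b v)"
  unfolding linear_extension_linear_extension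
proof (rule linear_extension_cong)
  fix p
  have "linear_extension reg_elem (b p) = 0" if "\<not> distinct_adj p"
    using reg_elem_regularize[of "b p"] assms(2)[OF that] by simp
  then show "linear_extension (\<lambda>q. linear_extension reg_elem (b q)) (reg_elem p) =
      linear_extension reg_elem (b p)"
    using assms(1) by (cases "distinct_adj p") (auto simp: reg_elem_def)
qed

section \<open>The regular boundary as a projection of the free boundary\<close>

lemma free_bd_eq_sum:
  "free_bd \<delta> p =
    (\<Sum>s<length p. Poly_Mapping.single (take s p @ drop (Suc s) p) ((- 1) ^ s * \<delta> (p ! s)))"
proof (induction p)
  case (Cons a p)
  have "cone a (sum f A) = (\<Sum>x\<in>A. cone a (f x))"
    for f :: "nat \<Rightarrow> ('a, 'b) chain" and A
    by (simp add: cone_def linear_extension_sum)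
  with Cons show ?case
    by (simp add: sum.lessThan_Suc_shift sum_negf single_uminus del: sum.lessThan_Suc)
qed simp

text \<open>The convention that the boundary vanishes in degree 0 matches
  \<open>reg_elem [] = 0\<close>: the free boundary of a single vertex is a multiple of
  \<open>[]\<close>.\<close>

lemma path_boundary_eq: "path_boundary \<delta> p = linear_extension reg_elem (free_bd \<delta> p)"
proof (cases "length p \<le> 1")
  case True
  then have "p = [] \<or> (\<exists>a. p = [a])"
    by (cases p) auto
  then show ?thesis
    by (auto simp: path_boundary_def reg_elem_def)
next
  case False
  then have "take s p @ drop (Suc s) p \<noteq> []" if "s < length p" for s
    using that by auto
  with False show ?thesis
    unfolding path_boundary_def free_bd_eq_sum linear_extension_sum
    by (auto simp: reg_elem_def intro!: sum.cong)
qed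

lemma boundary_eq:
  "boundary K v = linear_extension reg_elem (linear_extension (free_bd (pweight K)) v)"
proof -
  have "path_boundary (pweight K) = (\<lambda>p. linear_extension reg_elem (free_bd (pweight K) p))"
    by (rule ext) (rule path_boundary_eq)
  then show ?thesis
    by (simp add: boundary_def linear_extension_linear_extension)
qed

lemma boundary_boundary: "boundary K (boundary K v) = 0"
proof -
  let ?\<pi> = "linear_extension reg_elem" and ?D = "linear_extension (free_bd (pweight K))"
  have "boundary K (boundary K v) = ?\<pi> (?D (?D v))"
    unfolding boundary_eq by (rule reg_elem_absorb) (simp_all add: regularize_free_bd)
  also have "?D (?D v) = 0"
    by (simp add: linear_extension_linear_extension free_bd_free_bd) (simp add: linear_extension_def)
  finally show ?thesis
    by simp
qed

section \<open>Homology classes and equality of induced maps\<close>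

lemma boundary_linear:
  "boundary K (v + w) = boundary K v + boundary K w" "boundary K (- v) = - boundary K v"
  "boundary K 0 = 0"
  by (simp_all add: boundary_def)

lemma reg_chains_closed:
  assumes "v \<in> reg_chains K n" "w \<in> reg_chains K n"
  shows "v + w \<in> reg_chains K n" "- v \<in> reg_chains K n" "v - w \<in> reg_chains K n"
proof -
  have neg: "- v \<in> reg_chains K n" if "v \<in> reg_chains K n" for v :: "('a, 'b) chain"
    using that by (auto simp: reg_chains_def in_keys_iff)
  have add: "v + w \<in> reg_chains K n" if "v \<in> reg_chains K n" "w \<in> reg_chains K n"
    for v w :: "('a, 'b) chain"
    using that Poly_Mapping.keys_add[of v w] unfolding reg_chains_def by blast
  show "v + w \<in> reg_chains K n" "- v \<in> reg_chains K n" "v - w \<in> reg_chains K n"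
    using add[of v w] add[of v "- w"] neg[of v] neg[of w] assms by auto
qed

lemma boundaries_closed:
  assumes "v \<in> boundaries K n" "w \<in> boundaries K n"
  shows "v + w \<in> boundaries K n" "- v \<in> boundaries K n"
proof -
  obtain a b where a: "a \<in> Omega K (Suc n)" "v = boundary K a"
    and b: "b \<in> Omega K (Suc n)" "w = boundary K b"
    using assms by (auto simp: boundaries_def)
  have "a + b \<in> Omega K (Suc n)" "- a \<in> Omega K (Suc n)"
    using a(1) b(1) by (auto simp: Omega_def boundary_linear intro: reg_chains_closed)
  then have "boundary K (a + b) \<in> boundaries K n" "boundary K (- a) \<in> boundaries K n"
    unfolding boundaries_def by blast+
  then show "v + w \<in> boundaries K n" "- v \<in> boundaries K n"
    using a b by (simp_all add: boundary_linear)
qed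

lemma boundaries_subset: "boundaries K n \<subseteq> {v \<in> reg_chains K n. boundary K v = 0}"
  by (auto simp: boundaries_def Omega_def boundary_boundary)

text \<open>A direct argument with translates, resting on closure of the boundaries under addition
  and negation.\<close>

lemma boundaries_coset_eq:
  assumes "w - v \<in> boundaries K n"
  shows "boundaries K n #>\<^bsub>cycle_group K n\<^esub> v = boundaries K n #>\<^bsub>cycle_group K n\<^esub> w"
proof -
  have "boundaries K n #>\<^bsub>cycle_group K n\<^esub> v \<subseteq> boundaries K n #>\<^bsub>cycle_group K n\<^esub> w"
    if "w - v \<in> boundaries K n" for v w
  proof
    fix z assume "z \<in> boundaries K n #>\<^bsub>cycle_group K n\<^esub> v"
    then obtain h where h: "h \<in> boundaries K n" "z = h + v"
      by (auto simp: r_coset_def cycle_group_def)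
    have "h + - (w - v) \<in> boundaries K n"
      using h(1) that by (intro boundaries_closed)
    moreover have "z = (h + - (w - v)) + w"
      using h(2) by simp
    ultimately show "z \<in> boundaries K n #>\<^bsub>cycle_group K n\<^esub> w"
      by (auto simp: r_coset_def cycle_group_def intro!: bexI[of _ "h + - (w - v)"])
  qed
  moreover have "v - w \<in> boundaries K n"
    using boundaries_closed(2)[OF assms assms] by simp
  ultimately show ?thesis
    using assms by blast
qed

lemma coset_members:
  assumes "c \<in> carrier (path_homology K n)" "z \<in> c"
  shows "z \<in> reg_chains K n" "boundary K z = 0"
proof -
  obtain z' h where z': "z' \<in> cycles K n" and h: "h \<in> boundaries K n" and z: "z = h + z'"
    using assms
    by (auto simp: path_homology_def FactGroup_def RCOSETS_def cycle_group_def r_coset_def)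
  have "h \<in> reg_chains K n" "boundary K h = 0"
    using h boundaries_subset by blast+
  moreover have "z' \<in> reg_chains K n" "boundary K z' = 0"
    using z' by (auto simp: cycles_def Omega_def)
  ultimately show "z \<in> reg_chains K n" "boundary K z = 0"
    unfolding z by (auto simp: boundary_linear intro: reg_chains_closed)
qed

text \<open>Both maps are restricted to the same carrier, and the unions defining their values are
  compared member by member.\<close>

lemma path_homology_map_eqI:
  assumes "\<And>z. z \<in> reg_chains K n \<Longrightarrow> boundary K z = 0 \<Longrightarrow>
    chain_map y z - chain_map x z \<in> boundaries L n"
  shows "path_homology_map K L n x = path_homology_map K L n y"
  unfolding path_homology_map_def
proof (rule restrict_ext)
  fix c assume c: "c \<in> carrier (path_homology K n)"
  show "(\<Union>z\<in>c. boundaries L n #>\<^bsub>cycle_group L n\<^esub> chain_map x z) =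
      (\<Union>z\<in>c. boundaries L n #>\<^bsub>cycle_group L n\<^esub> chain_map y z)"
    by (intro SUP_cong refl boundaries_coset_eq assms coset_members[OF c])
qed


section \<open>Homotopy invariance\<close>

text \<open>The sequences in \<open>z\<close> have length \<open>Suc n\<close>, so their images are
  non-empty and \<open>reg_elem\<close> agrees with \<open>path_elem\<close> on them.\<close>

lemma chain_map_eq:
  assumes "z \<in> reg_chains K n"
  shows "chain_map f z = linear_extension reg_elem (push f z)"
  unfolding chain_map_def push_def linear_extension_linear_extension
  by (rule linear_extension_cong) (use assms in \<open>auto simp: reg_elem_def reg_chains_def\<close>)

text \<open>The projected prism over a cycle \<open>z\<close> is a chain whose boundary is the
  difference of the two images of \<open>z\<close>. Since this difference consists of paths of
  \<open>L\<close>, the chain lies in \<open>Omega\<close>.\<close>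

lemma path_homology_map_homotopic:
  fixes K :: "('v, 'r::{comm_ring, comm_monoid_mult}) weighted_path_complex"
    and L :: "('w, 'r) weighted_path_complex"
  assumes weights: "\<And>a. a \<in> pverts K \<Longrightarrow>
      pweight L (x a) = pweight K a \<and> pweight L (y a) = pweight K a \<and> u a * pweight K a = 1"
    and verts: "\<And>p. p \<in> paths K \<Longrightarrow> set p \<subseteq> pverts K"
    and maps: "\<And>p. p \<in> paths K \<Longrightarrow> map x p \<in> paths L \<and> map y p \<in> paths L"
    and prisms: "\<And>p. p \<in> paths K \<Longrightarrow>
      Poly_Mapping.keys (prism u x y p) \<subseteq> {q \<in> paths L. length q = Suc (length p)}"
  shows "path_homology_map K L n x = path_homology_map K L n y"
proof (rule path_homology_map_eqI)
  fix z assume z: "z \<in> reg_chains K n" and cycle: "boundary K z = 0"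
  let ?\<pi> = "\<lambda>v. linear_extension reg_elem v"
  let ?D = "linear_extension (free_bd (pweight L))"
    and ?D' = "linear_extension (free_bd (pweight K))" and ?P = "linear_extension (prism u x y)"
  have keys: "p \<in> paths K" "length p = Suc n" if "p \<in> Poly_Mapping.keys z" for p
    using z that by (auto simp: reg_chains_def)
  define h where "h = ?\<pi> (?P z)"
  \<comment> \<open>The prism descends to regular sequences, so the free boundary of
    \<open>z\<close> may be replaced by its regular boundary, which is zero.\<close>
  have "?\<pi> (?P (?D' z)) = ?\<pi> (?P (boundary K z))"
    unfolding boundary_eq by (rule reg_elem_absorb[symmetric]) (simp_all add: regularize_prism)
  then have PD: "?\<pi> (?P (?D' z)) = 0"
    by (simp add: cycle)
  have "?D (?P z) + ?P (?D' z) = push y z - push x z"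
    unfolding linear_extension_linear_extension push_def linear_extension_fun_add[symmetric]
      linear_extension_fun_diff[symmetric]
  proof (rule linear_extension_cong)
    fix p assume "p \<in> Poly_Mapping.keys z"
    then have "set p \<subseteq> pverts K"
      using keys verts by blast
    then show "?D (prism u x y p) + ?P (free_bd (pweight K) p) =
        Poly_Mapping.single (map y p) 1 - Poly_Mapping.single (map x p) 1"
      by (intro prism_homotopy weights) auto
  qed
  from arg_cong[OF this, of ?\<pi>] have "?\<pi> (?D (?P z)) = chain_map y z - chain_map x z"
    by (simp add: PD chain_map_eq[OF z])
  moreover have "boundary L h = ?\<pi> (?D (?P z))"
    unfolding boundary_eq h_def by (rule reg_elem_absorb) (simp_all add: regularize_free_bd)
  ultimately have bd: "boundary L h = chain_map y z - chain_map x z"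
    by simp
  have "h \<in> reg_chains L (Suc n)"
  proof -
    have "Poly_Mapping.keys (reg_elem q :: ('w, 'r) chain) \<subseteq>
        {r \<in> paths L. distinct_adj r \<and> length r = Suc (Suc n)}"
      if "p \<in> Poly_Mapping.keys z" "q \<in> Poly_Mapping.keys (prism u x y p)" for p q
      using prisms[OF keys(1)[OF that(1)]] that keys(2)[OF that(1)]
      by (auto simp: reg_elem_def path_elem_def split: if_splits)
    then show ?thesis
      unfolding h_def reg_chains_def linear_extension_linear_extension
      by (intro CollectI keys_linear_extension) blast
  qed
  moreover have "chain_map f z \<in> reg_chains L n" if "f = x \<or> f = y" for f
  proof -
    have "Poly_Mapping.keys (path_elem (map f p) :: ('w, 'r) chain) \<subseteq>
        {r \<in> paths L. distinct_adj r \<and> length r = Suc n}" if "p \<in> Poly_Mapping.keys z" for p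
      using maps[OF keys(1)[OF that]] keys(2)[OF that] \<open>f = x \<or> f = y\<close>
      by (auto simp: path_elem_def split: if_splits)
    then show ?thesis
      unfolding chain_map_def reg_chains_def by (intro CollectI keys_linear_extension)
  qed
  \<comment> \<open>By \<open>bd\<close>, the boundary of \<open>h\<close> is a difference of two
    chains of \<open>reg_chains L n\<close>.\<close>
  ultimately have "h \<in> Omega L (Suc n)"
    unfolding Omega_def by (auto simp: bd intro: reg_chains_closed)
  then show "chain_map y z - chain_map x z \<in> boundaries L n"
    unfolding boundaries_def bd[symmetric] by (rule imageI)
qed

text \<open>Each summand runs along the image under \<open>x\<close>, crosses once from
  \<open>x a\<close> to \<open>y a\<close>, and continues along the image under \<open>y\<close>.
  The clause on \<open>hd q\<close> strengthens the induction so that \<open>x a\<close> can be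
  attached in front.\<close>

lemma keys_prism:
  assumes "successively E p" "p \<noteq> []" "set p \<subseteq> V" "q \<in> Poly_Mapping.keys (prism u x y p)"
    and "\<And>a b. a \<in> V \<Longrightarrow> b \<in> V \<Longrightarrow> E a b \<Longrightarrow> E' (x a) (x b) \<and> E' (y a) (y b)"
    and "\<And>a. a \<in> V \<Longrightarrow> E' (x a) (y a)"
  shows "successively E' q \<and> q \<noteq> [] \<and> hd q = x (hd p) \<and> set q \<subseteq> x ` V \<union> y ` V
    \<and> length q = Suc (length p)"
  using assms(1-4)
proof (induction p arbitrary: q)
  case (Cons a p)
  have "q \<in> Poly_Mapping.keys (Poly_Mapping.single (x a # y a # map y p) (u a)) \<union>
      Poly_Mapping.keys (cone (x a) (prism u x y p))"
    using Cons.prems(4) keys_diff by fastforce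
  then consider "q = x a # y a # map y p"
    | "q \<in> Poly_Mapping.keys (cone (x a) (prism u x y p))"
    by (auto split: if_splits)
  then show ?case
  proof cases
    case 1
    have "successively E' (map y (a # p))"
      unfolding successively_map
      by (rule successively_mono[OF Cons.prems(1)]) (use Cons.prems(3) assms(5) in auto)
    with 1 show ?thesis
      using Cons.prems(3) assms(6) by auto
  next
    case 2
    have "Poly_Mapping.keys (cone (x a) (prism u x y p)) \<subseteq>
        (#) (x a) ` Poly_Mapping.keys (prism u x y p)"
      unfolding cone_def by (rule keys_linear_extension) auto
    with 2 obtain r where q: "q = x a # r" and r: "r \<in> Poly_Mapping.keys (prism u x y p)"
      by auto
    have "p \<noteq> []"
      using r by auto
    with Cons.prems(1,3) have p: "successively E p" "E a (hd p)" "a \<in> V" "set p \<subseteq> V"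
      by (auto simp: successively_Cons)
    have "hd p \<in> V"
      using p(4) \<open>p \<noteq> []\<close> by auto
    then show ?thesis
      using Cons.IH[OF p(1) \<open>p \<noteq> []\<close> p(4) r] p assms(5)
      by (auto simp: q successively_Cons)
  qed
qed simp

lemma path_homology_map_cong:
  assumes "\<And>p. p \<in> paths K \<Longrightarrow> map x p = map y p"
  shows "path_homology_map K L n x = path_homology_map K L n y"
proof (rule path_homology_map_eqI)
  fix z assume "z \<in> reg_chains K n"
  then have "map y p = map x p" if "p \<in> Poly_Mapping.keys z" for p
    using assms[of p] that unfolding reg_chains_def by (metis (no_types, lifting) mem_Collect_eq subsetD)
  then have "chain_map y z = chain_map x z"
    unfolding chain_map_def by (intro linear_extension_cong) (rule arg_cong)
  moreover have "0 \<in> boundaries L n"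
    unfolding boundaries_def
    by (rule image_eqI[of _ _ 0]) (auto simp: Omega_def reg_chains_def boundary_linear)
  ultimately show "chain_map y z - chain_map x z \<in> boundaries L n"
    by simp
qed

section \<open>From morphisms and homotopies of hypergraphs to arrows and weights\<close>

lemma P01_subset:
  assumes "directed_hypergraph G" "A \<in> P01 G"
  shows "A \<subseteq> verts G" "A \<noteq> {}" "finite A"
proof -
  obtain B where B: "(A, B) \<in> arrows G \<or> (B, A) \<in> arrows G"
    using assms(2) unfolding P01_def by fastforce
  have ends: "C \<noteq> {} \<and> D \<noteq> {} \<and> C \<union> D \<subseteq> verts G" if "(C, D) \<in> arrows G" for C D
    using assms(1) that unfolding directed_hypergraph_def by auto
  show sub: "A \<subseteq> verts G" and "A \<noteq> {}"
    using B ends by blast+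
  have "finite (verts G)"
    using assms(1) unfolding directed_hypergraph_def by blast
  with sub show "finite A"
    by (rule finite_subset)
qed

text \<open>Needed because the ends of a homotopy sequence agree with the given morphisms only on
  \<open>G\<close>.\<close>

lemma edge_homology_map_cong:
  assumes "directed_hypergraph G" "dh_map_eq G f g"
  shows "edge_homology_map G H n f = edge_homology_map G H n g"
  unfolding edge_homology_map_def
proof (rule path_homology_map_cong)
  fix p assume "p \<in> paths (Dw (Nw G))"
  then have "A \<subseteq> verts G" if "A \<in> set p" for A
    using that P01_subset(1)[OF assms(1)] by (auto simp: Dw_def Nw_def)
  then show "map ((`) (vmap f)) p = map ((`) (vmap g)) p"
    using assms(2) by (fastforce simp: dh_map_eq_def intro!: image_cong)
qed

lemma edge_weighted_morphismD:
  assumes "edge_weighted_morphism G H f"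
  shows "(A, B) \<in> arrows G \<Longrightarrow> (vmap f ` A, vmap f ` B) \<in> arrows H"
    and "A \<in> P01 G \<Longrightarrow> set_weight H (vmap f ` A) = set_weight G A"
proof -
  have arrow: "(vmap f ` A, vmap f ` B) \<in> arrows H \<and>
      set_weight H (vmap f ` A) = set_weight G A \<and> set_weight H (vmap f ` B) = set_weight G B"
    if "(A, B) \<in> arrows G" for A B
    using assms that unfolding edge_weighted_morphism_def dh_morphism_def by fastforce
  then show "(A, B) \<in> arrows G \<Longrightarrow> (vmap f ` A, vmap f ` B) \<in> arrows H"
    by blast
  show "A \<in> P01 G \<Longrightarrow> set_weight H (vmap f ` A) = set_weight G A"
    using arrow unfolding P01_def by fastforce
qed

lemma arrows_P01: "(A, B) \<in> arrows G \<Longrightarrow> A \<in> P01 G \<and> B \<in> P01 G"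
  unfolding P01_def by force

text \<open>The hypothesis \<open>arr\<close> provides the crossing arrows of the prism. The
  opposite orientation of the interval is covered by exchanging \<open>f\<close> and
  \<open>g\<close>.\<close>

lemma edge_homology_map_one_arrow:
  assumes inv: "\<And>A. A \<in> P01 G \<Longrightarrow> u A * set_weight G A = 1"
    and f: "edge_weighted_morphism G H f" and g: "edge_weighted_morphism G H g"
    and arr: "\<And>A. A \<in> P01 G \<Longrightarrow> (vmap f ` A, vmap g ` A) \<in> arrows H"
  shows "edge_homology_map G H n f = edge_homology_map G H n g"
  unfolding edge_homology_map_def
proof (rule path_homology_map_homotopic[where u = u])
  let ?E = "\<lambda>A B. (A, B) \<in> arrows G" and ?E' = "\<lambda>A B. (A, B) \<in> arrows H"
  have img: "vmap f ` A \<in> P01 H \<and> vmap g ` A \<in> P01 H" if "A \<in> P01 G" for A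
    using arrows_P01[OF arr[OF that]] .
  show "pweight (Dw (Nw H)) (vmap f ` A) = pweight (Dw (Nw G)) A \<and>
      pweight (Dw (Nw H)) (vmap g ` A) = pweight (Dw (Nw G)) A \<and> u A * pweight (Dw (Nw G)) A = 1"
    if "A \<in> pverts (Dw (Nw G))" for A
    using that edge_weighted_morphismD(2)[OF f] edge_weighted_morphismD(2)[OF g] inv
    by (auto simp: Dw_def Nw_def)
  fix p assume "p \<in> paths (Dw (Nw G))"
  then have p: "p \<noteq> []" "set p \<subseteq> P01 G" "successively ?E p"
    by (auto simp: Dw_def Nw_def)
  show "set p \<subseteq> pverts (Dw (Nw G))"
    using p(2) by (simp add: Dw_def Nw_def)
  have "successively ?E' (map ((`) (vmap f)) p)" "successively ?E' (map ((`) (vmap g)) p)"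
    unfolding successively_map
    by (rule successively_mono[OF p(3)], use f g edge_weighted_morphismD(1) in blast)+
  then show "map ((`) (vmap f)) p \<in> paths (Dw (Nw H)) \<and> map ((`) (vmap g)) p \<in> paths (Dw (Nw H))"
    using p(1,2) img by (auto simp: Dw_def Nw_def)
  show "Poly_Mapping.keys (prism u ((`) (vmap f)) ((`) (vmap g)) p)
      \<subseteq> {q \<in> paths (Dw (Nw H)). length q = Suc (length p)}"
  proof
    fix q assume "q \<in> Poly_Mapping.keys (prism u ((`) (vmap f)) ((`) (vmap g)) p)"
    from keys_prism[OF p(3,1,2) this, of ?E'] have "successively ?E' q \<and> q \<noteq> [] \<and>
        set q \<subseteq> (`) (vmap f) ` P01 G \<union> (`) (vmap g) ` P01 G \<and> length q = Suc (length p)"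
      using edge_weighted_morphismD(1)[OF f] edge_weighted_morphismD(1)[OF g] arr by blast
    then show "q \<in> {q \<in> paths (Dw (Nw H)). length q = Suc (length p)}"
      using img by (auto simp: Dw_def Nw_def)
  qed
qed

text \<open>These are the images of the arrows \<open>A \<times> {i}\<close> to
  \<open>A \<times> {j}\<close> of the box product; the two alternatives are the two orientations of
  the interval.\<close>

lemma one_step_homotopic_arrows:
  assumes G: "directed_hypergraph G" and "one_step_homotopic G H f0 f1"
  shows "(\<forall>A\<in>P01 G. (vmap f0 ` A, vmap f1 ` A) \<in> arrows H) \<or>
    (\<forall>A\<in>P01 G. (vmap f1 ` A, vmap f0 ` A) \<in> arrows H)"
proof -
  obtain i j F where ij: "(i, j) \<in> {(0, 1), (1, 0)}"
    and F: "dh_morphism (box_I1 G i j) H F"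
    and eq: "dh_map_eq G (slice F 0) f0" "dh_map_eq G (slice F 1) f1"
    using assms(2) unfolding one_step_homotopic_def by blast
  have im: "vmap F ` (A \<times> {0}) = vmap f0 ` A" "vmap F ` (A \<times> {1}) = vmap f1 ` A"
    if "A \<in> P01 G" for A
  proof -
    have "vmap F (v, 0) = vmap f0 v" "vmap F (v, 1) = vmap f1 v" if "v \<in> A" for v
      using eq P01_subset(1)[OF G \<open>A \<in> P01 G\<close>] that by (auto simp: dh_map_eq_def slice_def)
    then show "vmap F ` (A \<times> {0}) = vmap f0 ` A" "vmap F ` (A \<times> {1}) = vmap f1 ` A"
      by force+
  qed
  have "(vmap F ` (A \<times> {i}), vmap F ` (A \<times> {j})) \<in> arrows H" if "A \<in> P01 G" for A
  proof -
    have "(A \<times> {i}, A \<times> {j}) \<in> arrows (box_I1 G i j)"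
      using that by (auto simp: box_I1_def)
    then show ?thesis
      using F unfolding dh_morphism_def by fastforce
  qed
  with ij im show ?thesis
    by auto
qed

text \<open>
  The sort of the coefficients does not provide \<^const>\<open>of_nat\<close>, so cardinalities enter the
  coefficient ring through \<open>\<phi>\<close>.
\<close>

lemma set_weight_invertible:
  fixes \<phi> :: "rat \<Rightarrow> 'r::{comm_ring, comm_monoid_mult}"
    and G :: "('a, 'r) weighted_dihypergraph"
  assumes \<phi>: "rat_algebra \<phi>" and "finite A" "A \<noteq> {}" "\<forall>v\<in>A. weight G v = 1"
  shows "\<phi> (inverse (rat_of_nat (card A))) * set_weight G A = 1"
proof -
  have one: "\<phi> 1 = 1" and add: "\<phi> (a + b) = \<phi> a + \<phi> b" and mult: "\<phi> (a * b) = \<phi> a * \<phi> b" for a b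
    using \<phi> by (auto simp: rat_algebra_def)
  have zero: "\<phi> 0 = 0"
    using add[of 0 0] by simp
  \<comment> \<open>With all weights \<open>1\<close>, the total is the image of the cardinality, a
    nonzero rational since \<open>A\<close> is finite and non-empty.\<close>
  have "set_weight G A = \<phi> (rat_of_nat (card A))"
    unfolding set_weight_def using assms(2,4)
    by (induction A) (auto simp: zero one add)
  then show ?thesis
    using assms(2,3) by (simp add: mult[symmetric] one)
qed

theorem theorem3p8:
  fixes \<phi> :: "rat \<Rightarrow> 'r::{comm_ring, comm_monoid_mult}"
    and G :: "('a, 'r) weighted_dihypergraph"
    and H :: "('b, 'r) weighted_dihypergraph"
    and f g :: "('a, 'b) dh_map"
    and n :: nat
  assumes "rat_algebra \<phi>"
    and "directed_hypergraph G" and "directed_hypergraph H"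
    and "\<forall>v \<in> verts G. weight G v = 1" and "\<forall>v \<in> verts H. weight H v = 1"
    and "edge_weighted_morphism G H f" and "edge_weighted_morphism G H g"
    and "edge_homotopic G H f g"
  shows "edge_homology_map G H n f = edge_homology_map G H n g"
proof -
  obtain m h where h: "\<forall>k\<le>m. edge_weighted_morphism G H (h k)"
    "dh_map_eq G f (h 0)" "dh_map_eq G (h m) g"
    "\<forall>k<m. one_step_homotopic G H (h k) (h (Suc k))"
    using assms(8) unfolding edge_homotopic_def by blast
  \<comment> \<open>The prism coefficient of a vertex \<open>A\<close> is the inverse of its
    cardinality, taken in the rationals and mapped into the ring.\<close>
  have inv: "\<phi> (inverse (rat_of_nat (card A))) * set_weight G A = 1" if "A \<in> P01 G" for A
    using P01_subset[OF assms(2) that] assms(1,4) by (intro set_weight_invertible) auto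
  have step: "edge_homology_map G H n (h k) = edge_homology_map G H n (h (Suc k))" if "k < m" for k
  proof -
    have mor: "edge_weighted_morphism G H (h k)" "edge_weighted_morphism G H (h (Suc k))"
      using h(1) that by auto
    have "one_step_homotopic G H (h k) (h (Suc k))"
      using h(4) that by blast
    \<comment> \<open>Whichever way the arrows point, one of the two orders of \<open>h k\<close>
      and \<open>h (Suc k)\<close> applies.\<close>
    from one_step_homotopic_arrows[OF assms(2) this] show ?thesis
      using edge_homology_map_one_arrow[OF inv mor]
        edge_homology_map_one_arrow[OF inv mor(2) mor(1)] by metis
  qed
  have "edge_homology_map G H n (h 0) = edge_homology_map G H n (h k)" if "k \<le> m" for k
    using that by (induction k) (auto simp: step)
  then show ?thesis
    using edge_homology_map_cong[OF assms(2) h(2)] edge_homology_map_cong[OF assms(2) h(3)]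
    by (metis le_refl)
qed

end
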